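(* The Strong Image Conjecture holds for the Hermite polynomials and for the generalized Laguerre polynomials with $\alpha\in\mathbb Q$, $\alpha>-1$. That is, if $\Lambda=\partial_t-2t$, or if $\Lambda=\partial_t+(\alpha t^{-1}-1)$ with $\alpha\in\mathbb Q$ and $\alpha>-1$, and if $1\notin\mathrm{Im}'\Lambda$, then $\mathfrak r(\mathrm{Im}'\Lambda)=\{0\}$.
   Context: The operator $\Lambda$ maps $\mathbb C[t]$ into $\mathbb C[t,t^{-1}]$, with $\partial_t=d/dt$, and $\mathrm{Im}'\Lambda:=\mathbb C[t]\cap\Lambda(\mathbb C[t])$. For a subset $V$ of $\mathbb C[t]$, $\mathfrak r(V)=\{f\in\mathbb C[t] : f^m\in V\text{ for all sufficiently large } m\}$. *)

theory Defs
  imports Complex_Main "HOL-Computational_Algebra.Computational_Algebra"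
begin

text \<open>
  The ring of Laurent polynomials in \<open>t\<close> is represented inside the formal Laurent series
  \<^typ>\<open>complex fls\<close>, with \<open>t\<close> being \<^const>\<open>fls_X\<close>; the operators below only
  take values that are Laurent polynomials.
\<close>

definition fls_of_poly :: "complex poly \<Rightarrow> complex fls" where
  "fls_of_poly p = fps_to_fls (fps_of_poly p)"

text \<open>The operator \<open>d/dt + a\<close>, where \<open>a\<close> acts by multiplication.\<close>

definition deriv_plus :: "complex fls \<Rightarrow> complex poly \<Rightarrow> complex fls" where
  "deriv_plus a p = fls_deriv (fls_of_poly p) + a * fls_of_poly p"

definition hermite_op :: "complex poly \<Rightarrow> complex fls" where
  "hermite_op = deriv_plus (- 2 * fls_X)"

definition laguerre_op :: "rat \<Rightarrow> complex poly \<Rightarrow> complex fls" where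
  "laguerre_op \<alpha> = deriv_plus (fls_const (of_rat \<alpha>) * fls_X_inv - 1)"

text \<open>The intersection of the polynomial ring with the image, as a set of polynomials.\<close>

definition Im' :: "(complex poly \<Rightarrow> complex fls) \<Rightarrow> complex poly set" where
  "Im' \<Lambda> = {p. fls_of_poly p \<in> range \<Lambda>}"

definition power_radical :: "complex poly set \<Rightarrow> complex poly set" where
  "power_radical V = {f. \<exists>N. \<forall>m\<ge>N. f ^ m \<in> V}"

definition strong_image_conjecture :: "(complex poly \<Rightarrow> complex fls) \<Rightarrow> bool" where
  "strong_image_conjecture \<Lambda> \<longleftrightarrow> (1 \<notin> Im' \<Lambda> \<longrightarrow> power_radical (Im' \<Lambda>) = {0})"

end

theory Submission imports Defs
begin

text \<open>
  Polynomials in the image of \<open>\<Lambda>\<close> are annihilated by a linear functional \<open>L\<close>: integration against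
  the weight of the orthogonal polynomials, \<open>exp (- t\<^sup>2)\<close> on the line or \<open>t powr \<alpha> * exp (- t)\<close> on the
  half-line. Only its normalised moments matter. For Laguerre polynomials with \<open>\<alpha> = a / b\<close>, \<open>\<alpha> \<noteq> 0\<close>, they are
  \<open>L (t ^ n) = (\<alpha> + 1) \<dots> (\<alpha> + n)\<close>, that is, the product of the integers \<open>a + b * i\<close> for
  \<open>1 \<le> i \<le> n\<close>, divided by \<open>b ^ n\<close>. For Hermite polynomials the odd moments vanish and the moment of
  \<open>t ^ (2 * n)\<close> is the product for \<open>a = - 1\<close>, \<open>b = 2\<close> divided by \<open>2 ^ n\<close>. (For \<open>\<alpha> = 0\<close> the image contains
  \<open>1\<close>, and the conjecture holds vacuously.) It remains to see that a nonzero \<open>f\<close> has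
  \<open>L (f ^ p) \<noteq> 0\<close> for all large primes \<open>p\<close>.

  Let \<open>c t ^ s\<close> be the lowest term of \<open>f\<close>, and \<open>R\<close> a finitely generated subring of the complex
  numbers that contains the coefficients of \<open>f\<close>. Modulo \<open>p R[t]\<close>, the power \<open>f ^ p\<close> is the sum of the
  \<open>p\<close>-th powers of the terms of \<open>f\<close>. Among \<open>p\<close> consecutive terms of an arithmetic progression
  whose difference is prime to \<open>p\<close>, exactly one is divisible by \<open>p\<close>; so for large \<open>p\<close> the \<open>p\<close>-adic
  valuation of the moment of \<open>t ^ (s * p)\<close> is exactly \<open>s\<close>, it is at least \<open>s\<close> for all higher
  exponents, and at least \<open>s + 1\<close> for the exponents \<open>i * p\<close> with \<open>i > s\<close>. All contributions to
  \<open>L (f ^ p)\<close> other than \<open>c ^ p * L (t ^ (s * p))\<close> therefore carry an additional factor \<open>p\<close>, and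
  \<open>L (f ^ p) = 0\<close> would put \<open>c ^ p\<close> into \<open>p R\<close>
  (\<open>eventually_moment_prime_power_nonzero\<close>). In the Hermite case the same count, with half of \<open>s\<close>
  as the valuation, works for even \<open>s\<close>, which is achieved by replacing \<open>f\<close> with its square.

  The contradiction comes from a fact of commutative algebra: a nonzero element of a finitely
  generated domain of characteristic zero is nilpotent modulo \<open>p\<close> for only finitely many primes
  \<open>p\<close> (\<open>finitely_generated_nilpotent_mod_few_primes\<close>). Its proof adjoins the generators one at a time.
\<close>

section \<open>Subrings and adjunction of an element\<close>

locale subring =
  fixes R :: "'a::comm_ring_1 set"
  assumes one_mem: "1 \<in> R"
    and diff_mem: "x \<in> R \<Longrightarrow> y \<in> R \<Longrightarrow> x - y \<in> R"
    and mult_mem: "x \<in> R \<Longrightarrow> y \<in> R \<Longrightarrow> x * y \<in> R"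
begin

lemma zero_mem: "0 \<in> R"
  using diff_mem[OF one_mem one_mem] by simp

lemma uminus_mem: "x \<in> R \<Longrightarrow> - x \<in> R"
  using diff_mem[OF zero_mem] by simp

lemma add_mem: "x \<in> R \<Longrightarrow> y \<in> R \<Longrightarrow> x + y \<in> R"
  using diff_mem[OF _ uminus_mem] by fastforce

lemma power_mem: "x \<in> R \<Longrightarrow> x ^ n \<in> R"
  by (induction n) (auto intro: one_mem mult_mem)

lemma sum_mem: "(\<And>i. i \<in> I \<Longrightarrow> f i \<in> R) \<Longrightarrow> sum f I \<in> R"
  by (induction I rule: infinite_finite_induct) (auto intro: zero_mem add_mem)

lemma of_nat_mem: "of_nat n \<in> R"
  by (induction n) (auto intro: zero_mem one_mem add_mem)

lemma of_int_mem: "of_int n \<in> R"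
  by (cases n rule: int_cases2) (auto intro: of_nat_mem uminus_mem)

end

definition polys_over :: "'a::comm_ring_1 set \<Rightarrow> 'a poly set" where
  "polys_over R = {q. \<forall>i. coeff q i \<in> R}"

definition adjoin :: "'a::comm_ring_1 set \<Rightarrow> 'a \<Rightarrow> 'a set" where
  "adjoin R c = (\<lambda>q. poly q c) ` polys_over R"

lemma polys_overD: "q \<in> polys_over R \<Longrightarrow> coeff q i \<in> R"
  by (simp add: polys_over_def)

context subring
begin

lemma subring_polys_over: "subring (polys_over R)"
proof
  show "1 \<in> polys_over R"
    by (auto simp: polys_over_def coeff_1 intro: one_mem zero_mem)
next
  fix x y assume "x \<in> polys_over R" "y \<in> polys_over R"
  then show "x - y \<in> polys_over R" "x * y \<in> polys_over R"
    by (auto simp: polys_over_def coeff_mult intro!: diff_mem sum_mem mult_mem)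
qed

lemma subring_adjoin: "subring (adjoin R c)"
proof -
  interpret P: subring "polys_over R" by (rule subring_polys_over)
  show ?thesis
  proof
    show "1 \<in> adjoin R c"
      unfolding adjoin_def using P.one_mem by (metis image_eqI poly_1)
  next
    fix x y assume "x \<in> adjoin R c" "y \<in> adjoin R c"
    then obtain p q where "p \<in> polys_over R" "q \<in> polys_over R" "x = poly p c" "y = poly q c"
      by (auto simp: adjoin_def)
    then show "x - y \<in> adjoin R c" "x * y \<in> adjoin R c"
      unfolding adjoin_def image_iff by (metis P.diff_mem poly_diff, metis P.mult_mem poly_mult)
  qed
qed

lemma monom_mem: "a \<in> R \<Longrightarrow> monom a n \<in> polys_over R"
  by (simp add: polys_over_def zero_mem)

lemma const_mem: "a \<in> R \<Longrightarrow> [:a:] \<in> polys_over R"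
  by (metis monom_0 monom_mem)

lemma smult_mem: "a \<in> R \<Longrightarrow> q \<in> polys_over R \<Longrightarrow> smult a q \<in> polys_over R"
  by (simp add: polys_over_def mult_mem)

lemma subset_adjoin: "R \<subseteq> adjoin R c"
proof
  fix a assume "a \<in> R"
  then show "a \<in> adjoin R c"
    unfolding adjoin_def by (intro image_eqI[of _ _ "[:a:]"] const_mem) auto
qed

lemma generator_mem_adjoin: "c \<in> adjoin R c"
  unfolding adjoin_def
  by (intro image_eqI[of _ _ "monom 1 1"] monom_mem one_mem) (simp add: poly_monom)

end

lemma degree_pos_if_root:
  assumes "q \<noteq> 0" "poly q c = 0"
  shows "degree q > 0"
proof (rule ccontr)
  assume "\<not> degree q > 0"
  then obtain a where "q = [:a:]" by (auto elim: degree_eq_zeroE)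
  then show False using assms by simp
qed

lemma subring_Ints: "subring \<int>"
  by unfold_locales auto

text \<open>
  Division with remainder stays inside \<open>R[X]\<close> once the dividend is multiplied by a power of the
  leading coefficient of the divisor; each step of long division costs one such factor.
\<close>

lemma pseudo_division_over_subring:
  fixes R :: "'a::idom set"
  assumes "subring R" and m: "m \<in> polys_over R" and deg: "degree m > 0"
    and "q \<in> polys_over R"
  shows "\<exists>e Q r. Q \<in> polys_over R \<and> r \<in> polys_over R \<and> degree r < degree m \<and>
           smult (lead_coeff m ^ e) q = Q * m + r"
  using assms(4)
proof (induction "degree q" arbitrary: q rule: less_induct)
  case less
  interpret subring R by fact
  interpret P: subring "polys_over R" by (rule subring_polys_over)
  show ?case
  proof (cases "degree q < degree m")
    case True
    then show ?thesis using less.prems P.zero_mem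
      by (intro exI[of _ 0] exI[of _ 0] exI[of _ q]) auto
  next
    case False
    define b where "b = lead_coeff m"
    define s where "s = monom (lead_coeff q) (degree q - degree m)"
    define q' where "q' = smult b q - s * m"
    have bR: "b \<in> R" unfolding b_def using m by (rule polys_overD)
    have sP: "s \<in> polys_over R" unfolding s_def
      by (intro monom_mem polys_overD less.prems)
    have q'P: "q' \<in> polys_over R" unfolding q'_def
      by (intro P.diff_mem P.mult_mem smult_mem bR sP less.prems m)
    (* The leading terms of both summands of q' cancel. *)
    have "degree (s * m) \<le> degree q" unfolding s_def
      using False by (intro order.trans[OF degree_mult_le])
        (use degree_monom_le[of "lead_coeff q" "degree q - degree m"] in linarith)
    then have "degree q' \<le> degree q" unfolding q'_def
      by (intro degree_diff_le) (auto intro: order.trans[OF degree_smult_le])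
    moreover have "coeff q' (degree q) = 0"
      using False by (simp add: q'_def s_def b_def coeff_monom_mult)
    ultimately have "degree q' < degree q"
      using False deg by (metis bot_nat_0.not_eq_extremum degree_0 leading_coeff_0_iff le_neq_implies_less less_le_trans not_le)
    from less.hyps[OF this q'P] obtain e Q r where
      *: "Q \<in> polys_over R" "r \<in> polys_over R" "degree r < degree m"
         "smult (b ^ e) q' = Q * m + r"
      unfolding b_def by blast
    have "smult (b ^ Suc e) q = (Q + smult (b ^ e) s) * m + r"
      using *(4) by (simp add: q'_def algebra_simps smult_diff_right)
    moreover have "Q + smult (b ^ e) s \<in> polys_over R"
      by (intro P.add_mem smult_mem power_mem bR sP *)
    ultimately show ?thesis using * unfolding b_def by blast
  qed
qed

section \<open>Nilpotency modulo primes in finitely generated rings\<close>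

definition nilpotent_mod :: "nat \<Rightarrow> 'a::comm_ring_1 set \<Rightarrow> 'a \<Rightarrow> bool" where
  "nilpotent_mod p R a \<longleftrightarrow> (\<exists>k. \<exists>x\<in>R. a ^ k = of_nat p * x)"

text \<open>
  Nilpotency modulo \<open>p\<close>, rather than divisibility by \<open>p\<close> or invertibility of \<open>p\<close>, makes the
  property inductive: a nilpotent multiple of \<open>a\<close>, or a leading coefficient of \<open>a\<close>, can take the place
  of \<open>a\<close> when a generator is removed.
\<close>

definition nilpotent_mod_few_primes :: "'a::comm_ring_1 set \<Rightarrow> bool" where
  "nilpotent_mod_few_primes R \<longleftrightarrow>
     (\<forall>a\<in>R. a \<noteq> 0 \<longrightarrow> (\<forall>\<^sub>F p in sequentially. prime p \<longrightarrow> \<not> nilpotent_mod p R a))"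

lemma nilpotent_mod_few_primes_Ints:
  "nilpotent_mod_few_primes (\<int> :: 'a::{idom,ring_char_0} set)"
  unfolding nilpotent_mod_few_primes_def
proof (intro ballI impI)
  fix a :: 'a assume "a \<in> \<int>" "a \<noteq> 0"
  then obtain m where a: "a = of_int m" and "m \<noteq> 0" by (auto elim: Ints_cases)
  show "\<forall>\<^sub>F p in sequentially. prime p \<longrightarrow> \<not> nilpotent_mod p \<int> a"
    using eventually_gt_at_top[of "nat \<bar>m\<bar>"]
  proof eventually_elim
    case (elim p)
    show ?case
    proof (intro impI notI)
      assume "prime p" "nilpotent_mod p \<int> a"
      then obtain k x where x: "x \<in> \<int>" "(of_int m :: 'a) ^ k = of_nat p * x"
        unfolding nilpotent_mod_def a by blast
      from x(1) obtain y where "x = of_int y" by (rule Ints_cases)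
      then have "(of_int (m ^ k) :: 'a) = of_int (int p * y)" using x(2) by simp
      then have "m ^ k = int p * y" by (simp only: of_int_eq_iff)
      then have "int p dvd m ^ k" by simp
      moreover have "prime (int p)" using \<open>prime p\<close> by simp
      ultimately have "int p dvd m" by (blast dest: prime_dvd_power)
      then have "int p \<le> \<bar>m\<bar>" using dvd_imp_le_int[OF \<open>m \<noteq> 0\<close>] by fastforce
      then show False using elim by linarith
    qed
  qed
qed

text \<open>
  This is the algebraicity of \<open>1 / a\<close> over \<open>R\<close> in a form free of fractions. Among the
  nonzero \<open>h \<in> R[X]\<close> of degree below that of \<open>m\<close> whose value at \<open>c\<close> is a multiple of \<open>a\<close>, one of least
  degree is constant: otherwise the remainder of \<open>m\<close> modulo \<open>h\<close> would be zero by minimality, so that \<open>h\<close>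
  would give a factorisation of a multiple of \<open>m\<close> into polynomials of smaller degree, one of them
  vanishing at \<open>c\<close>.
\<close>

lemma nonzero_multiple_in_base_ring:
  fixes R :: "'a::idom set"
  assumes "subring R"
    and m: "m \<in> polys_over R" "m \<noteq> 0" "poly m c = 0"
    and minimal: "\<And>q. q \<in> polys_over R \<Longrightarrow> poly q c = 0 \<Longrightarrow> degree q < degree m \<Longrightarrow> q = 0"
    and a: "a \<in> adjoin R c" "a \<noteq> 0"
  shows "\<exists>y\<in>adjoin R c. a * y \<in> R \<and> a * y \<noteq> 0"
proof -
  interpret subring R by fact
  interpret P: subring "polys_over R" by (rule subring_polys_over)
  interpret A: subring "adjoin R c" by (rule subring_adjoin)
  have deg: "degree m > 0"
    using m(2,3) by (rule degree_pos_if_root)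
  define I where "I h \<longleftrightarrow> h \<in> polys_over R \<and> h \<noteq> 0 \<and> degree h < degree m \<and>
      (\<exists>y\<in>adjoin R c. poly h c = a * y)" for h
  obtain q where q: "q \<in> polys_over R" "a = poly q c" using a by (auto simp: adjoin_def)
  obtain e Q r where r: "Q \<in> polys_over R" "r \<in> polys_over R" "degree r < degree m"
      "smult (lead_coeff m ^ e) q = Q * m + r"
    using pseudo_division_over_subring[OF \<open>subring R\<close> m(1) deg q(1)] by blast
  have ra: "poly r c = a * lead_coeff m ^ e"
    using arg_cong[OF r(4), of "\<lambda>q. poly q c"] m(3) q(2) by (simp add: mult.commute)
  have "I r" unfolding I_def
  proof (intro conjI bexI)
    show "r \<noteq> 0" using ra a(2) m(2) by auto
    show "lead_coeff m ^ e \<in> adjoin R c"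
      using subset_adjoin power_mem polys_overD[OF m(1)] by blast
  qed (use r ra in auto)
  then obtain h where h: "I h" and hmin: "\<And>q. I q \<Longrightarrow> degree h \<le> degree q"
    using ex_has_least_nat[of I r degree] by blast
  from h obtain y where y: "h \<in> polys_over R" "h \<noteq> 0" "degree h < degree m"
      "y \<in> adjoin R c" "poly h c = a * y"
    unfolding I_def by blast
  have "degree h = 0"
  proof (rule ccontr)
    assume "degree h \<noteq> 0"
    then have hdeg: "degree h > 0" by simp
    obtain e Q r where r: "Q \<in> polys_over R" "r \<in> polys_over R" "degree r < degree h"
        "smult (lead_coeff h ^ e) m = Q * h + r"
      using pseudo_division_over_subring[OF \<open>subring R\<close> y(1) hdeg m(1)] by blast
    have "0 = poly Q c * poly h c + poly r c"
      using arg_cong[OF r(4), of "\<lambda>q. poly q c"] m(3) by simp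
    then have "poly r c = - (poly Q c * poly h c)"
      by (metis add.commute minus_unique)
    then have rc: "poly r c = a * (- (poly Q c * y))" using y(5) by (simp add: mult_ac)
    have "- (poly Q c * y) \<in> adjoin R c"
      using r(1) y(4) by (intro A.uminus_mem A.mult_mem) (auto simp: adjoin_def)
    then have "I r" if "r \<noteq> 0"
      unfolding I_def using that r(2,3) y(3) rc
      by (intro conjI bexI[of _ "- (poly Q c * y)"]) auto
    then have "r = 0" using hmin[of r] r(3) by fastforce
    then have eq: "smult (lead_coeff h ^ e) m = Q * h" using r(4) by simp
    have "Q * h \<noteq> 0" using m(2) y(2) unfolding eq[symmetric] by simp
    then have "Q \<noteq> 0" by auto
    have "degree m = degree Q + degree h"
      using arg_cong[OF eq, of degree] \<open>Q \<noteq> 0\<close> y(2) by (simp add: degree_mult_eq)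
    then have "degree Q < degree m" using hdeg by simp
    then have "poly Q c \<noteq> 0" using minimal r(1) \<open>Q \<noteq> 0\<close> by blast
    moreover have "poly h c \<noteq> 0" using minimal y by blast
    moreover have "poly Q c * poly h c = 0"
      using arg_cong[OF eq, of "\<lambda>q. poly q c"] m(3) by simp
    ultimately show False by simp
  qed
  then obtain d where d: "h = [:d:]" by (rule degree_eq_zeroE)
  then have "a * y = d" "d \<noteq> 0" using y(2,5) by auto
  moreover have "d \<in> R" using polys_overD[OF y(1), of 0] d by simp
  ultimately show ?thesis using y(4) by auto
qed

text \<open>
  Here \<open>R[c]\<close> is a polynomial ring, and if a power of a polynomial is divisible by \<open>p\<close>, so is the
  same power of its leading coefficient.
\<close>

lemma nilpotent_mod_few_primes_adjoin_transcendental: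
  fixes R :: "'a::idom set"
  assumes "subring R" and few: "nilpotent_mod_few_primes R"
    and trans: "\<And>q. q \<in> polys_over R \<Longrightarrow> poly q c = 0 \<Longrightarrow> q = 0"
  shows "nilpotent_mod_few_primes (adjoin R c)"
  unfolding nilpotent_mod_few_primes_def
proof (intro ballI impI)
  interpret subring R by fact
  interpret P: subring "polys_over R" by (rule subring_polys_over)
  fix a assume a: "a \<in> adjoin R c" "a \<noteq> 0"
  then obtain q where q: "q \<in> polys_over R" "a = poly q c" by (auto simp: adjoin_def)
  then have "lead_coeff q \<in> R" "lead_coeff q \<noteq> 0" using a(2) by (auto intro: polys_overD)
  then have "\<forall>\<^sub>F p in sequentially. prime p \<longrightarrow> \<not> nilpotent_mod p R (lead_coeff q)"
    using few unfolding nilpotent_mod_few_primes_def by blast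
  then show "\<forall>\<^sub>F p in sequentially. prime p \<longrightarrow> \<not> nilpotent_mod p (adjoin R c) a"
  proof eventually_elim
    case (elim p)
    have "nilpotent_mod p R (lead_coeff q)" if "nilpotent_mod p (adjoin R c) a"
    proof -
      from that obtain k z where z: "z \<in> polys_over R" "a ^ k = of_nat p * poly z c"
        unfolding nilpotent_mod_def adjoin_def by blast
      have "q ^ k - smult (of_nat p) z \<in> polys_over R"
        by (intro P.diff_mem P.power_mem smult_mem of_nat_mem q z)
      moreover have "poly (q ^ k - smult (of_nat p) z) c = 0" using z q by simp
      ultimately have "q ^ k = smult (of_nat p) z" using trans by fastforce
      then have "coeff (q ^ k) (degree (q ^ k)) = of_nat p * coeff z (degree (q ^ k))" by simp
      then have "lead_coeff q ^ k = of_nat p * coeff z (degree (q ^ k))"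
        by (simp only: lead_coeff_power)
      then show ?thesis unfolding nilpotent_mod_def using polys_overD[OF z(1)] by blast
    qed
    then show ?case using elim by blast
  qed
qed

text \<open>
  Let \<open>m\<close> have least degree among the nonzero polynomials over \<open>R\<close> vanishing at \<open>c\<close>, and let \<open>b\<close> be
  its leading coefficient. Over \<open>R[1 / b]\<close> the ring generated by \<open>c\<close> is free with basis the powers of \<open>c\<close>
  below \<open>degree m\<close>, and \<open>1\<close> is one of the basis elements. So an element of \<open>R\<close> divisible by \<open>p\<close> in \<open>R[c]\<close>
  becomes divisible by \<open>p\<close> in \<open>R\<close> after multiplication by a power of \<open>b\<close>. This is applied to powers of a
  nonzero multiple \<open>a * y \<in> R\<close> of the given element.
\<close>

lemma nilpotent_mod_few_primes_adjoin_algebraic: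
  fixes R :: "'a::idom set"
  assumes "subring R" and few: "nilpotent_mod_few_primes R"
    and alg: "q0 \<in> polys_over R" "poly q0 c = 0" "q0 \<noteq> 0"
  shows "nilpotent_mod_few_primes (adjoin R c)"
  unfolding nilpotent_mod_few_primes_def
proof (intro ballI impI)
  interpret subring R by fact
  interpret P: subring "polys_over R" by (rule subring_polys_over)
  interpret A: subring "adjoin R c" by (rule subring_adjoin)
  fix a assume a: "a \<in> adjoin R c" "a \<noteq> 0"
  obtain m where m: "m \<in> polys_over R" "m \<noteq> 0" "poly m c = 0"
    and mmin: "\<And>q. q \<in> polys_over R \<and> poly q c = 0 \<and> q \<noteq> 0 \<Longrightarrow> degree m \<le> degree q"
    using ex_has_least_nat[of "\<lambda>q. q \<in> polys_over R \<and> poly q c = 0 \<and> q \<noteq> 0" q0 degree] alg by blast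
  have minimal: "q = 0" if "q \<in> polys_over R" "poly q c = 0" "degree q < degree m" for q
    using mmin[of q] that by force
  have deg: "degree m > 0"
    using m(2,3) by (rule degree_pos_if_root)
  obtain y where y: "y \<in> adjoin R c" "a * y \<in> R" "a * y \<noteq> 0"
    using nonzero_multiple_in_base_ring[OF \<open>subring R\<close> m minimal a] by blast
  define b where "b = lead_coeff m"
  have b: "b \<in> R" "b \<noteq> 0" using m polys_overD[OF m(1)] by (auto simp: b_def)
  have "b * (a * y) \<in> R" "b * (a * y) \<noteq> 0" using b y mult_mem by auto
  then have "\<forall>\<^sub>F p in sequentially. prime p \<longrightarrow> \<not> nilpotent_mod p R (b * (a * y))"
    using few unfolding nilpotent_mod_few_primes_def by blast
  then show "\<forall>\<^sub>F p in sequentially. prime p \<longrightarrow> \<not> nilpotent_mod p (adjoin R c) a"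
  proof eventually_elim
    case (elim p)
    have "nilpotent_mod p R (b * (a * y))" if "nilpotent_mod p (adjoin R c) a"
    proof -
      from that obtain k x where x: "x \<in> adjoin R c" "a ^ k = of_nat p * x"
        unfolding nilpotent_mod_def by blast
      then have "x * y ^ k \<in> adjoin R c" by (intro A.mult_mem A.power_mem y)
      then obtain z where z: "z \<in> polys_over R" "x * y ^ k = poly z c" by (auto simp: adjoin_def)
      obtain e Q z' where z': "Q \<in> polys_over R" "z' \<in> polys_over R" "degree z' < degree m"
          "smult (b ^ e) z = Q * m + z'"
        using pseudo_division_over_subring[OF \<open>subring R\<close> m(1) deg z(1)] unfolding b_def by blast
      have red: "b ^ e * poly z c = poly z' c"
        using arg_cong[OF z'(4), of "\<lambda>q. poly q c"] m(3) by simp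
      have "b ^ e * (a * y) ^ k = b ^ e * (of_nat p * (x * y ^ k))"
        by (simp add: x(2) power_mult_distrib mult_ac)
      also have "\<dots> = of_nat p * poly z' c" unfolding z(2) red[symmetric] by (simp add: mult_ac)
      finally have val: "b ^ e * (a * y) ^ k = of_nat p * poly z' c" .
      (* Comparing coefficients of the powers of c below degree m: w vanishes at c and has
         too small a degree to be nonzero. *)
      define w where "w = [:b ^ e * (a * y) ^ k:] - smult (of_nat p) z'"
      have "w = 0"
      proof (rule minimal)
        show "w \<in> polys_over R" unfolding w_def
          by (intro P.diff_mem const_mem smult_mem of_nat_mem mult_mem power_mem b y z')
        show "poly w c = 0" unfolding w_def using val by simp
        have "degree w \<le> degree z'" unfolding w_def
          by (intro degree_diff_le) (auto intro: order.trans[OF degree_smult_le])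
        then show "degree w < degree m" using z'(3) by simp
      qed
      then have "coeff w 0 = 0" by simp
      then have c0: "b ^ e * (a * y) ^ k = of_nat p * coeff z' 0" by (simp add: w_def)
      have "(b * (a * y)) ^ (e + k) = b ^ k * (a * y) ^ e * (b ^ e * (a * y) ^ k)"
        by (simp only: power_mult_distrib power_add mult_ac)
      also have "\<dots> = of_nat p * (b ^ k * (a * y) ^ e * coeff z' 0)"
        unfolding c0 by (simp add: mult_ac)
      finally have "(b * (a * y)) ^ (e + k) = of_nat p * (b ^ k * (a * y) ^ e * coeff z' 0)" .
      moreover have "b ^ k * (a * y) ^ e * coeff z' 0 \<in> R"
        by (intro mult_mem power_mem b y polys_overD z')
      ultimately show ?thesis unfolding nilpotent_mod_def by blast
    qed
    then show ?case using elim by blast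
  qed
qed

lemma finitely_generated_nilpotent_mod_few_primes:
  fixes X :: "'a::{idom,ring_char_0} set"
  assumes "finite X"
  shows "\<exists>R. subring R \<and> X \<subseteq> R \<and> nilpotent_mod_few_primes R"
  using assms
proof (induction X rule: finite_induct)
  case empty
  show ?case using subring_Ints nilpotent_mod_few_primes_Ints by blast
next
  case (insert c X)
  then obtain R where R: "subring R" "X \<subseteq> R" "nilpotent_mod_few_primes R" by blast
  have "nilpotent_mod_few_primes (adjoin R c)"
  proof (cases "\<exists>q\<in>polys_over R. poly q c = 0 \<and> q \<noteq> 0")
    case True
    then show ?thesis using nilpotent_mod_few_primes_adjoin_algebraic R by blast
  next
    case False
    then show ?thesis using nilpotent_mod_few_primes_adjoin_transcendental R by blast
  qed
  then show ?case
    using R subring.subring_adjoin subring.subset_adjoin subring.generator_mem_adjoin by blast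
qed

section \<open>Prime powers of polynomials\<close>

lemma (in subring) prime_power_of_sum:
  assumes "prime p" "x \<in> R" "y \<in> R"
  shows "\<exists>z\<in>R. (x + y) ^ p = x ^ p + y ^ p + of_nat p * z"
proof -
  have p: "p > 1" using assms(1) by (rule prime_gt_1_nat)
  define z where "z = (\<Sum>i\<in>{1..<p}. of_nat ((p choose i) div p) * x ^ i * y ^ (p - i))"
  have dv: "p dvd (p choose i)" if "i \<in> {1..<p}" for i
    using that assms(1) by (intro dvd_choose_prime) auto
  have "{..p} = insert 0 (insert p {1..<p})" using p by auto
  then have "(x + y) ^ p = x ^ p + y ^ p + (\<Sum>i\<in>{1..<p}. of_nat (p choose i) * x ^ i * y ^ (p - i))"
    using p by (simp add: binomial_ring add_ac)
  also have "(\<Sum>i\<in>{1..<p}. of_nat (p choose i) * x ^ i * y ^ (p - i)) = of_nat p * z"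
    unfolding z_def sum_distrib_left
  proof (rule sum.cong)
    fix i assume "i \<in> {1..<p}"
    then have "p choose i = p * ((p choose i) div p)" using dv by simp
    then have "(of_nat (p choose i) :: 'a) = of_nat p * of_nat ((p choose i) div p)"
      by (metis of_nat_mult)
    then show "of_nat (p choose i) * x ^ i * y ^ (p - i) =
        of_nat p * (of_nat ((p choose i) div p) * x ^ i * y ^ (p - i))"
      by (simp only: mult.assoc)
  qed simp
  finally show ?thesis
    unfolding z_def using assms by (blast intro: sum_mem mult_mem of_nat_mem power_mem)
qed

text \<open>
  The Frobenius congruence in \<open>R[t]\<close> modulo \<open>p\<close>, read off coefficient by coefficient. The error term is
  kept over \<open>R\<close>, since \<open>p\<close> may well be invertible in the ambient ring.
\<close>

lemma (in subring) coeff_prime_power: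
  assumes "prime p" "g \<in> polys_over R"
  shows "\<exists>z\<in>polys_over R. \<forall>n. coeff (g ^ p) n =
           (if p dvd n then coeff g (n div p) ^ p else 0) + of_nat p * coeff z n"
  using assms(2)
proof (induction g)
  case 0
  have "p > 0" using assms(1) by (rule prime_gt_0_nat)
  then show ?case using zero_mem by (intro bexI[of _ 0]) (auto simp: polys_over_def power_0_left)
next
  case (pCons a q)
  interpret P: subring "polys_over R" by (rule subring_polys_over)
  have p: "p > 0" using assms(1) by (rule prime_gt_0_nat)
  have aR: "a \<in> R" using polys_overD[OF pCons.prems, of 0] by simp
  have qR: "q \<in> polys_over R" using polys_overD[OF pCons.prems, of "Suc _"] by (simp add: polys_over_def)
  obtain z1 where z1: "z1 \<in> polys_over R" "\<And>n. coeff (q ^ p) n =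
           (if p dvd n then coeff q (n div p) ^ p else 0) + of_nat p * coeff z1 n"
    using pCons.IH[OF qR] by blast
  have xR: "monom 1 1 * q \<in> polys_over R" by (intro P.mult_mem monom_mem one_mem qR)
  obtain z2 where z2: "z2 \<in> polys_over R"
      "([:a:] + monom 1 1 * q) ^ p = [:a:] ^ p + (monom 1 1 * q) ^ p + of_nat p * z2"
    using P.prime_power_of_sum[OF assms(1) const_mem[OF aR] xR] by blast
  have split: "pCons a q = [:a:] + monom 1 1 * q"
    by (simp add: monom_altdef)
  have eq: "pCons a q ^ p = [:a ^ p:] + monom 1 p * q ^ p + smult (of_nat p) z2"
    unfolding split z2(2) by (simp add: poly_const_pow power_mult_distrib monom_power of_nat_poly)
  show ?case
  proof (intro bexI allI)
    show "monom 1 p * z1 + z2 \<in> polys_over R"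
      by (intro P.add_mem P.mult_mem monom_mem one_mem z1 z2)
    fix n
    show "coeff (pCons a q ^ p) n = (if p dvd n then coeff (pCons a q) (n div p) ^ p else 0)
        + of_nat p * coeff (monom 1 p * z1 + z2) n"
    proof (cases "n < p")
      case True
      then show ?thesis unfolding eq using p
        by (cases n) (auto simp: coeff_monom_mult dest: dvd_imp_le)
    next
      case False
      then obtain j where n: "n = p + j" using le_Suc_ex by (metis not_less)
      have "coeff [:a ^ p:] n = 0" using False p by (cases n) auto
      then show ?thesis unfolding eq using p
        by (simp add: n coeff_monom_mult z1(2) distrib_left)
    qed
  qed
qed

lemma coeff_power_below_order:
  assumes "\<forall>i<s. coeff g i = 0" "n < s * p"
  shows "coeff (g ^ p) n = 0"
proof -
  have "monom 1 s dvd g" using assms(1) by (simp add: monom_1_dvd_iff')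
  then have "monom 1 s ^ p dvd g ^ p" by (rule dvd_power_same)
  then show ?thesis using assms(2) by (simp add: monom_power monom_1_dvd_iff')
qed

section \<open>Linear functionals given by moments\<close>

definition moment_functional :: "(nat \<Rightarrow> 'a) \<Rightarrow> 'a::comm_ring_1 poly \<Rightarrow> 'a" where
  "moment_functional u f = (\<Sum>i\<le>degree f. coeff f i * u i)"

lemma moment_functional_upto:
  assumes "degree f \<le> N"
  shows "moment_functional u f = (\<Sum>i\<le>N. coeff f i * u i)"
  unfolding moment_functional_def using assms
  by (intro sum.mono_neutral_left) (auto simp: coeff_eq_0)

lemma moment_functional_add:
  "moment_functional u (f + g) = moment_functional u f + moment_functional u g"
proof -
  define N where "N = max (degree f) (degree g)"
  have "degree (f + g) \<le> N" "degree f \<le> N" "degree g \<le> N"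
    unfolding N_def by (auto intro: degree_add_le_max)
  then show ?thesis by (simp add: moment_functional_upto algebra_simps sum.distrib)
qed

lemma moment_functional_diff:
  "moment_functional u (f - g) = moment_functional u f - moment_functional u g"
  using moment_functional_add[of u "f - g" g] by simp

lemma moment_functional_monom: "moment_functional u (monom c n) = c * u n"
proof -
  have "moment_functional u (monom c n) = (\<Sum>i\<le>n. if i = n then c * u n else 0)"
    unfolding moment_functional_upto[OF degree_monom_le] by (intro sum.cong) auto
  then show ?thesis by simp
qed

lemma additive_vanishing_on_monomials:
  fixes \<phi> :: "'a::comm_ring_1 poly \<Rightarrow> 'b::ab_group_add"
  assumes add: "\<And>f g. \<phi> (f + g) = \<phi> f + \<phi> g" and "\<And>c n. \<phi> (monom c n) = 0"
  shows "\<phi> f = 0"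
proof -
  have zero: "\<phi> 0 = 0" using add[of 0 0] by simp
  have "\<phi> (\<Sum>i\<in>I. monom (coeff f i) i) = 0" if "finite I" for I
    using that by (induction I rule: finite_induct) (auto simp: assms zero)
  from this[of "{..degree f}"] show ?thesis by (simp add: poly_as_sum_of_monoms)
qed

text \<open>
  The moments are integers \<open>v n\<close> up to a geometric factor. That factor amounts to the substitution
  \<open>t \<mapsto> \<gamma> t\<close>, and it does not affect the argument if \<open>\<gamma>\<close> is among the generators of \<open>R\<close>.
  Under the assumption on valuations, every contribution to the functional at \<open>g ^ p\<close> is divisible by
  \<open>p ^ (k + 1)\<close> in \<open>R\<close>, except for \<open>c ^ p * v (s * p) * \<gamma> ^ (s * p)\<close> with \<open>c\<close> the lowest coefficient,
  where \<open>v (s * p)\<close> has valuation exactly \<open>k\<close>. If the functional vanished at \<open>g ^ p\<close>, division by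
  \<open>p ^ k\<close> would make \<open>c * \<gamma> ^ s\<close> nilpotent modulo \<open>p\<close>.
\<close>

lemma eventually_moment_prime_power_nonzero:
  fixes g :: "'a::{idom,ring_char_0} poly"
  assumes order: "coeff g s \<noteq> 0" "\<forall>i<s. coeff g i = 0"
    and u: "\<And>n. u n = of_int (v n) * \<gamma> ^ n" and "\<gamma> \<noteq> 0"
    and val: "\<forall>\<^sub>F p in sequentially. prime p \<longrightarrow>
        (\<forall>n\<ge>s * p. int p ^ k dvd v n) \<and> \<not> int p ^ Suc k dvd v (s * p) \<and>
        (\<forall>i>s. int p ^ Suc k dvd v (i * p))"
  shows "\<forall>\<^sub>F p in sequentially. prime p \<longrightarrow> moment_functional u (g ^ p) \<noteq> 0"
proof -
  have "finite (insert \<gamma> (set (coeffs g)))" by simp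
  from finitely_generated_nilpotent_mod_few_primes[OF this]
  obtain R where R: "subring R" "insert \<gamma> (set (coeffs g)) \<subseteq> R" "nilpotent_mod_few_primes R"
    by (elim exE conjE)
  interpret subring R by fact
  have \<gamma>R: "\<gamma> \<in> R" using R(2) by simp
  have "coeff g i \<in> R" for i
  proof -
    have "coeff g i \<in> insert 0 (set (coeffs g))" unfolding range_coeff[symmetric] by (rule rangeI)
    then show ?thesis using subsetD[OF R(2)] zero_mem by (cases "coeff g i = 0") auto
  qed
  then have gR: "g \<in> polys_over R" by (simp add: polys_over_def)
  define a where "a = coeff g s * \<gamma> ^ s"
  have "a \<in> R" unfolding a_def by (intro mult_mem power_mem \<gamma>R polys_overD[OF gR])
  moreover have "a \<noteq> 0" unfolding a_def using \<open>\<gamma> \<noteq> 0\<close> order(1) by simp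
  ultimately have "\<forall>\<^sub>F p in sequentially. prime p \<longrightarrow> \<not> nilpotent_mod p R a"
    using R(3) unfolding nilpotent_mod_few_primes_def by blast
  with val show ?thesis
  proof eventually_elim
    case (elim p)
    show ?case
    proof (intro impI notI)
      assume "prime p" and zero: "moment_functional u (g ^ p) = 0"
      have p: "p > 0" using \<open>prime p\<close> by (rule prime_gt_0_nat)
      have v1: "\<And>n. n \<ge> s * p \<Longrightarrow> int p ^ k dvd v n" and v2: "\<not> int p ^ Suc k dvd v (s * p)"
        and v3: "\<And>i. i > s \<Longrightarrow> int p ^ Suc k dvd v (i * p)"
        using elim(1) \<open>prime p\<close> by auto
      (* J is the ideal of R that absorbs all contributions but the leading one. *)
      define P :: 'a where "P = of_nat p ^ Suc k"
      define J where "J = (*) P ` R"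
      have J0: "0 \<in> J" unfolding J_def by (rule image_eqI[OF _ zero_mem]) simp
      have Jadd: "x + y \<in> J" if "x \<in> J" "y \<in> J" for x y
        using that unfolding J_def image_iff by (metis add_mem distrib_left)
      have Jsum: "sum f I \<in> J" if "\<And>i. i \<in> I \<Longrightarrow> f i \<in> J" for f and I :: "nat set"
        using that by (induction I rule: infinite_finite_induct) (auto intro: J0 Jadd)
      have JI: "x \<in> J" if "x = of_int d * y" "int p ^ Suc k dvd d" "y \<in> R" for x d y
      proof -
        obtain e where "d = int p ^ Suc k * e" using \<open>int p ^ Suc k dvd d\<close> by (rule dvdE)
        then have "x = P * (of_int e * y)" using that(1) by (simp add: P_def mult_ac)
        then show ?thesis unfolding J_def
          by (rule image_eqI) (intro mult_mem of_int_mem that(3))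
      qed
      obtain z where z: "z \<in> polys_over R" "\<And>n. coeff (g ^ p) n =
           (if p dvd n then coeff g (n div p) ^ p else 0) + of_nat p * coeff z n"
        using coeff_prime_power[OF \<open>prime p\<close> gR] by blast
      (* The error term of the Frobenius congruence brings one factor p, the moment brings the
         other k. *)
      have pz: "of_nat p * coeff z n * u n \<in> J" if "n \<ge> s * p" for n
      proof (rule JI)
        show "of_nat p * coeff z n * u n = of_int (int p * v n) * (coeff z n * \<gamma> ^ n)"
          by (simp add: u mult_ac)
        show "int p ^ Suc k dvd int p * v n"
          unfolding power_Suc by (intro mult_dvd_mono v1 that dvd_refl)
        show "coeff z n * \<gamma> ^ n \<in> R" by (intro mult_mem power_mem \<gamma>R polys_overD z)
      qed
      have off: "coeff (g ^ p) n * u n \<in> J" if "n \<noteq> s * p" for n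
      proof (cases "n < s * p")
        case True
        then show ?thesis using coeff_power_below_order[OF order(2)] J0 by simp
      next
        case False
        then have n: "n > s * p" using that by simp
        have "(if p dvd n then coeff g (n div p) ^ p else 0) * u n \<in> J"
        proof (cases "p dvd n")
          case True
          then obtain i where i: "n = i * p" by (metis dvdE mult.commute)
          then have "i > s" using n by simp
          show ?thesis
          proof (rule JI)
            show "(if p dvd n then coeff g (n div p) ^ p else 0) * u n =
                of_int (v n) * (coeff g i ^ p * \<gamma> ^ n)"
              using p by (simp add: i u mult_ac)
            show "int p ^ Suc k dvd v n" unfolding i by (rule v3[OF \<open>i > s\<close>])
            show "coeff g i ^ p * \<gamma> ^ n \<in> R"
              by (intro mult_mem power_mem \<gamma>R polys_overD gR)
          qed
        qed (simp add: J0)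
        then show ?thesis
          unfolding z(2) distrib_right using pz[of n] n by (intro Jadd) auto
      qed
      define N where "N = max (s * p) (degree (g ^ p))"
      have "0 = (\<Sum>n\<le>N. coeff (g ^ p) n * u n)"
        using zero moment_functional_upto[of "g ^ p" N u] by (simp add: N_def)
      also have "\<dots> = coeff (g ^ p) (s * p) * u (s * p) +
          (\<Sum>n\<in>{..N} - {s * p}. coeff (g ^ p) n * u n)"
        by (intro sum.remove) (auto simp: N_def)
      also have "coeff (g ^ p) (s * p) * u (s * p) =
          coeff g s ^ p * u (s * p) + of_nat p * coeff z (s * p) * u (s * p)"
        using p by (simp add: z(2) distrib_right)
      finally have "coeff g s ^ p * u (s * p) + (of_nat p * coeff z (s * p) * u (s * p) +
          (\<Sum>n\<in>{..N} - {s * p}. coeff (g ^ p) n * u n)) = 0"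
        by (simp only: add.assoc)
      then have "- (coeff g s ^ p * u (s * p)) = of_nat p * coeff z (s * p) * u (s * p) +
          (\<Sum>n\<in>{..N} - {s * p}. coeff (g ^ p) n * u n)"
        by (rule minus_unique)
      moreover have "\<dots> \<in> J" by (intro Jadd Jsum pz off) auto
      ultimately have "- (coeff g s ^ p * u (s * p)) \<in> J" by (simp only:)
      then obtain x where x: "x \<in> R"
          "- (coeff g s ^ p * u (s * p)) = of_nat p ^ Suc k * x"
        unfolding J_def P_def by (rule imageE)
      obtain w where w: "v (s * p) = int p ^ k * w" by (rule dvdE[OF v1[OF order_refl]])
      have "\<not> int p dvd w"
        using v2 mult_dvd_mono[OF dvd_refl, of "int p" w "int p ^ k"] unfolding w power_Suc2
        by (rule contrapos_nn)
      then have "coprime (int p) w"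
        using \<open>prime p\<close> by (intro prime_imp_coprime) auto
      (* The integer w is prime to p, so it can be removed from w * a ^ p by a Bezout relation. *)
      then obtain \<beta> \<delta> where bez: "\<beta> * int p + \<delta> * w = 1"
        using bezout_int[of "int p" w] by (auto simp: coprime_iff_gcd_eq_1)
      have "u (s * p) = of_nat p ^ k * of_int w * (\<gamma> ^ s) ^ p"
        by (simp add: u w power_mult)
      then have "of_nat p ^ k * (of_int w * a ^ p) = coeff g s ^ p * u (s * p)"
        by (simp add: a_def power_mult_distrib mult_ac)
      also have "\<dots> = of_nat p ^ k * (of_nat p * (- x))"
        using arg_cong[OF x(2), of uminus] by (simp add: mult_ac)
      finally have "of_nat p ^ k * (of_int w * a ^ p) = of_nat p ^ k * (of_nat p * (- x))" .
      moreover have "(of_nat p ^ k :: 'a) \<noteq> 0" using p by simp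
      ultimately have wa: "of_int w * a ^ p = of_nat p * (- x)" by (metis mult_left_cancel)
      have "a ^ p = of_int (\<beta> * int p + \<delta> * w) * a ^ p" unfolding bez by simp
      also have "\<dots> = of_nat p * (of_int \<beta> * a ^ p) + of_int \<delta> * (of_int w * a ^ p)"
        by (simp only: of_int_add of_int_mult of_int_of_nat_eq distrib_right mult.assoc mult.left_commute)
      also have "\<dots> = of_nat p * (of_int \<beta> * a ^ p - of_int \<delta> * x)"
        unfolding wa by (simp add: algebra_simps)
      finally have "nilpotent_mod p R a"
        unfolding nilpotent_mod_def
        by (intro exI bexI) (assumption, intro diff_mem mult_mem of_int_mem power_mem \<open>a \<in> R\<close> x(1))
      then show False using elim(2) \<open>prime p\<close> by blast
    qed
  qed
qed

section \<open>Divisibility of products along arithmetic progressions\<close>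

definition progression_prod :: "int \<Rightarrow> int \<Rightarrow> nat \<Rightarrow> int" where
  "progression_prod a b n = (\<Prod>i=1..n. a + b * int i)"

lemma progression_prod_0 [simp]: "progression_prod a b 0 = 1"
  by (simp add: progression_prod_def)

lemma progression_prod_Suc [simp]:
  "progression_prod a b (Suc n) = progression_prod a b n * (a + b * int (Suc n))"
  by (simp add: progression_prod_def)

lemma progression_prod_add:
  "progression_prod a b (m + n) = progression_prod a b m * progression_prod (a + b * int m) b n"
  by (induction n) (auto simp: algebra_simps)

lemma progression_prod_dvd: "m \<le> n \<Longrightarrow> progression_prod a b m dvd progression_prod a b n"
  by (metis progression_prod_add dvd_triv_left le_Suc_ex)

text \<open>
  Since \<open>b\<close> is invertible modulo \<open>p\<close>, the \<open>p\<close> terms represent every residue class once.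
\<close>

lemma unique_multiple_in_block:
  assumes "prime p" "coprime b (int p)"
  shows "\<exists>!i. i \<in> {1..p} \<and> int p dvd a + b * int i"
proof -
  have p: "p > 0" using assms(1) by (rule prime_gt_0_nat)
  have inj: "inj_on (\<lambda>i. (a + b * int i) mod int p) {1..p}"
  proof (rule inj_onI)
    fix i j assume ij: "i \<in> {1..p}" "j \<in> {1..p}"
      "(a + b * int i) mod int p = (a + b * int j) mod int p"
    then have "int p dvd (a + b * int i) - (a + b * int j)" by (simp only: mod_eq_dvd_iff)
    then have "int p dvd b * (int i - int j)" by (simp add: algebra_simps)
    then have "int p dvd int i - int j"
      using assms(2) by (simp add: coprime_dvd_mult_right_iff coprime_commute)
    moreover have "\<bar>int i - int j\<bar> < int p" using ij by auto
    ultimately have "int i - int j = 0" using zdvd_not_zless[of "\<bar>int i - int j\<bar>" "int p"] by fastforce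
    then show "i = j" by simp
  qed
  have "(\<lambda>i. (a + b * int i) mod int p) ` {1..p} = {0..<int p}"
    using inj p by (intro card_subset_eq) (auto simp: card_image)
  then have "0 \<in> (\<lambda>i. (a + b * int i) mod int p) ` {1..p}" using p by simp
  then obtain i where i: "i \<in> {1..p}" "(a + b * int i) mod int p = 0" by auto
  show ?thesis
  proof (rule ex1I[of _ i])
    show "i \<in> {1..p} \<and> int p dvd a + b * int i" using i by auto
    fix j assume "j \<in> {1..p} \<and> int p dvd a + b * int j"
    then show "j = i" using i inj_onD[OF inj, of j i] by auto
  qed
qed

lemma progression_block:
  assumes "prime p" "coprime b (int p)"
  shows "int p dvd progression_prod a b p"
    and "0 < a + b \<Longrightarrow> 0 \<le> b \<Longrightarrow> a + b * int p < int p ^ 2 \<Longrightarrow>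
      \<not> int p ^ 2 dvd progression_prod a b p"
proof -
  obtain i where i: "i \<in> {1..p}" "int p dvd a + b * int i"
    and uniq: "\<And>j. j \<in> {1..p} \<Longrightarrow> int p dvd a + b * int j \<Longrightarrow> j = i"
    using unique_multiple_in_block[OF assms, of a] by blast
  have p: "prime (int p)" using assms(1) by simp
  define B where "B = (\<Prod>j\<in>{1..p} - {i}. a + b * int j)"
  have eq: "progression_prod a b p = (a + b * int i) * B"
    unfolding progression_prod_def B_def using i by (intro prod.remove) auto
  then show "int p dvd progression_prod a b p" using i by simp
  have "\<not> int p dvd B"
    unfolding B_def using p uniq by (auto simp: prime_dvd_prod_iff)
  then have cop: "coprime (int p ^ 2) B" using p by (simp add: prime_imp_coprime)
  assume pos: "0 < a + b" "0 \<le> b" and small: "a + b * int p < int p ^ 2"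
  show "\<not> int p ^ 2 dvd progression_prod a b p"
  proof
    assume "int p ^ 2 dvd progression_prod a b p"
    then have "int p ^ 2 dvd a + b * int i"
      using cop unfolding eq by (simp add: coprime_dvd_mult_left_iff)
    moreover have "b * 1 \<le> b * int i" "b * int i \<le> b * int p"
      using i pos by (intro mult_left_mono; simp)+
    ultimately show False using pos small zdvd_not_zless[of "a + b * int i" "int p ^ 2"] by linarith
  qed
qed

lemma prime_power_dvd_progression_prod:
  assumes "prime p" "coprime b (int p)"
  shows "int p ^ j dvd progression_prod a b (j * p)"
proof (induction j)
  case (Suc j)
  have "progression_prod a b (Suc j * p) =
      progression_prod a b (j * p) * progression_prod (a + b * int (j * p)) b p"
    by (metis add.commute mult_Suc progression_prod_add)
  then show ?case
    unfolding power_Suc2 by (simp only: mult_dvd_mono Suc progression_block(1)[OF assms])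
qed auto

text \<open>
  The smallness assumption keeps the first \<open>s * p\<close> factors below \<open>p\<^sup>2\<close>, so that each of the \<open>s\<close> blocks of length \<open>p\<close>
  contributes exactly one factor \<open>p\<close>.
\<close>

lemma prime_power_not_dvd_progression_prod:
  assumes "prime p" "coprime b (int p)" "0 < a + b" "0 \<le> b"
    and "a + b * (int s * int p) < int p ^ 2" "j \<le> s"
  shows "\<not> int p ^ Suc j dvd progression_prod a b (j * p)"
  using assms(6)
proof (induction j)
  case 0
  have "int p > 1" using assms(1) prime_gt_1_nat by auto
  then show ?case by auto
next
  case (Suc j)
  define A where "A = progression_prod a b (j * p)"
  define B where "B = progression_prod (a + b * int (j * p)) b p"
  have p: "prime (int p)" using assms(1) by simp
  have eq: "progression_prod a b (Suc j * p) = A * B"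
    unfolding A_def B_def by (metis add.commute mult_Suc progression_prod_add)
  have "b * (int (Suc j) * int p) \<le> b * (int s * int p)"
    using Suc.prems assms(4) by (intro mult_left_mono mult_right_mono) auto
  then have small: "a + b * int (j * p) + b * int p < int p ^ 2"
    using assms(5) by (simp add: algebra_simps)
  have pos: "0 < a + b * int (j * p) + b"
  proof -
    have "0 \<le> b * int (j * p)" using assms(4) by simp
    then show ?thesis using assms(3) by linarith
  qed
  have B: "int p dvd B" "\<not> int p ^ 2 dvd B"
    unfolding B_def using progression_block[OF assms(1,2)] pos assms(4) small by blast+
  then obtain B' where B': "B = int p * B'" by (auto elim: dvdE)
  have nB': "\<not> int p dvd B'" using B(2) unfolding B' by (auto simp: power2_eq_square)
  obtain A' where A': "A = int p ^ j * A'"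
    using prime_power_dvd_progression_prod[OF assms(1,2), of j a] unfolding A_def by (auto elim: dvdE)
  have nA': "\<not> int p dvd A'"
    using Suc unfolding A_def[symmetric] A' by (auto simp: mult.commute mult_dvd_mono)
  have "int p \<noteq> 0" using p by auto
  have "\<not> int p ^ Suc (Suc j) dvd int p ^ Suc j * (A' * B')"
  proof
    assume "int p ^ Suc (Suc j) dvd int p ^ Suc j * (A' * B')"
    then have "int p ^ Suc j * int p dvd int p ^ Suc j * (A' * B')" by (simp only: power_Suc2)
    then have "int p dvd A' * B'" using \<open>int p \<noteq> 0\<close> by (simp only: dvd_mult_cancel_left) auto
    then show False using p nA' nB' by (simp add: prime_dvd_mult_iff)
  qed
  then show ?case unfolding eq A' B' by (simp add: mult_ac)
qed

lemma eventually_progression_valuation: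
  assumes "0 < a + b" "0 < b"
  shows "\<forall>\<^sub>F p in sequentially. prime p \<longrightarrow>
     (\<forall>n\<ge>s * p. int p ^ s dvd progression_prod a b n) \<and>
     \<not> int p ^ Suc s dvd progression_prod a b (s * p) \<and>
     (\<forall>n\<ge>Suc s * p. int p ^ Suc s dvd progression_prod a b n)"
  (* This bound makes p exceed b, hence prime to b, and keeps a + b * s * p below the square of p. *)
  using eventually_gt_at_top[of "nat (\<bar>a\<bar> + b * (int s + 1))"]
proof eventually_elim
  case (elim p)
  show ?case
  proof
    assume "prime p"
    have big: "\<bar>a\<bar> + b * (int s + 1) < int p" using elim by linarith
    have "0 \<le> b * int s" using assms by simp
    then have "b < int p" using big by (simp add: algebra_simps)
    then have "\<not> int p dvd b" using assms(2) zdvd_not_zless by blast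
    then have cop: "coprime b (int p)"
      using \<open>prime p\<close> by (metis coprime_commute prime_imp_coprime prime_nat_int_transfer)
    have p1: "1 \<le> int p" using \<open>prime p\<close> prime_ge_1_nat by auto
    have "\<bar>a\<bar> * 1 \<le> \<bar>a\<bar> * int p" using p1 by (intro mult_left_mono) auto
    then have "a + b * (int s * int p) \<le> \<bar>a\<bar> * int p + b * (int s * int p)" by linarith
    also have "\<dots> \<le> (\<bar>a\<bar> + b * (int s + 1)) * int p" using assms p1 by (simp add: algebra_simps)
    also have "\<dots> < int p * int p" using big p1 by (intro mult_strict_right_mono) auto
    finally have small: "a + b * (int s * int p) < int p ^ 2" by (simp add: power2_eq_square)
    show "(\<forall>n\<ge>s * p. int p ^ s dvd progression_prod a b n) \<and>
     \<not> int p ^ Suc s dvd progression_prod a b (s * p) \<and>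
     (\<forall>n\<ge>Suc s * p. int p ^ Suc s dvd progression_prod a b n)"
      using prime_power_dvd_progression_prod[OF \<open>prime p\<close> cop]
        prime_power_not_dvd_progression_prod[OF \<open>prime p\<close> cop assms(1) _ small order_refl] assms(2)
        progression_prod_dvd dvd_trans
      by (meson less_imp_le)
  qed
qed

section \<open>Radicals of kernels of the moment functionals\<close>

lemma nonzero_poly_order:
  fixes f :: "'a::zero poly"
  assumes "f \<noteq> 0"
  obtains s where "coeff f s \<noteq> 0" "\<forall>i<s. coeff f i = 0"
proof -
  have "coeff f (degree f) \<noteq> 0" using assms by simp
  then have "coeff f (LEAST s. coeff f s \<noteq> 0) \<noteq> 0" by (rule LeastI)
  moreover have "\<forall>i<(LEAST s. coeff f s \<noteq> 0). coeff f i = 0"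
    by (intro allI impI) (drule not_less_Least, simp)
  ultimately show ?thesis by (rule that)
qed

text \<open>
  Membership in the radical concerns all large exponents, so the infinitely many prime ones suffice
  to refute it.
\<close>

lemma eventually_prime_nonzero_imp_not_in_radical:
  assumes "\<forall>\<^sub>F p in sequentially. prime p \<longrightarrow> moment_functional u (f ^ p) \<noteq> 0"
    and "V \<subseteq> {f. moment_functional u f = 0}"
  shows "f \<notin> power_radical V"
proof
  assume "f \<in> power_radical V"
  then have "\<forall>\<^sub>F m in sequentially. f ^ m \<in> V"
    by (auto simp: power_radical_def eventually_sequentially)
  with assms(1) have "\<forall>\<^sub>F p in sequentially. \<not> prime (p :: nat)"
    by eventually_elim (use assms(2) in auto)
  then obtain M where "\<And>p :: nat. p \<ge> M \<Longrightarrow> \<not> prime p" by (auto simp: eventually_sequentially)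
  moreover obtain p :: nat where "prime p" "p > M" using bigger_prime by blast
  ultimately show False by (meson less_imp_le)
qed

lemma power_in_power_radical:
  assumes "f \<in> power_radical V" "n > 0"
  shows "f ^ n \<in> power_radical V"
proof -
  obtain N where N: "\<forall>m\<ge>N. f ^ m \<in> V" using assms(1) by (auto simp: power_radical_def)
  have "(f ^ n) ^ m \<in> V" if "m \<ge> N" for m
  proof -
    have "1 * m \<le> n * m" using assms(2) by (intro mult_le_mono1) simp
    then have "n * m \<ge> N" using that by linarith
    then show ?thesis using N by (simp flip: power_mult)
  qed
  then show ?thesis by (auto simp: power_radical_def)
qed

text \<open>
  The following rules turn an equation between values of the operators, which lives in the Laurent
  series, into an equation between polynomials.
\<close>

lemma fls_of_poly_inject: "fls_of_poly p = fls_of_poly q \<longleftrightarrow> p = q"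
  by (simp add: fls_of_poly_def fps_of_poly_eq_iff)

lemma fls_nth_fls_of_poly: "fls_nth (fls_of_poly p) n = (if n < 0 then 0 else coeff p (nat n))"
  by (simp add: fls_of_poly_def)

lemma fls_of_poly_add: "fls_of_poly (p + q) = fls_of_poly p + fls_of_poly q"
  by (simp add: fls_of_poly_def fps_of_poly_add fps_to_fls_plus)

lemma fls_of_poly_diff: "fls_of_poly (p - q) = fls_of_poly p - fls_of_poly q"
  by (simp add: fls_of_poly_def fps_of_poly_diff fps_to_fls_minus)

lemma fls_of_poly_monom1_mult: "fls_of_poly (monom 1 1 * q) = fls_X * fls_of_poly q"
  by (simp add: fls_of_poly_def fps_of_poly_mult fps_of_poly_monom fls_times_fps_to_fls)

lemma fls_of_poly_smult: "fls_of_poly (smult c q) = fls_const c * fls_of_poly q"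
  by (simp add: fls_of_poly_def fps_of_poly_smult fls_times_fps_to_fls)

lemma fls_deriv_fls_of_poly: "fls_deriv (fls_of_poly q) = fls_of_poly (pderiv q)"
  by (simp add: fls_of_poly_def fls_deriv_fps_to_fls fps_of_poly_pderiv)

lemma zero_in_radical_Im'_deriv_plus: "0 \<in> power_radical (Im' (deriv_plus a))"
proof -
  have "fls_of_poly 0 = deriv_plus a 0" by (simp add: deriv_plus_def fls_of_poly_def)
  then have "0 \<in> Im' (deriv_plus a)" by (auto simp: Im'_def)
  then show ?thesis
    by (auto simp: power_radical_def power_0_left intro!: exI[of _ 1])
qed

section \<open>Generalized Laguerre polynomials\<close>

text \<open>
  The rising factorial \<open>(\<alpha> + 1) \<dots> (\<alpha> + n)\<close> for \<open>\<alpha> = a / b\<close>, with the denominators collected.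
\<close>

definition laguerre_moment :: "int \<Rightarrow> int \<Rightarrow> nat \<Rightarrow> complex" where
  "laguerre_moment a b n = of_int (progression_prod a b n) * (1 / of_int b) ^ n"

text \<open>
  For \<open>\<alpha> \<noteq> 0\<close>, the value of the operator at \<open>q\<close> is a polynomial only if \<open>q\<close> has no constant term, as
  \<open>\<alpha> / t\<close> times that term has to vanish. On \<open>q = t ^ (n + 1)\<close> the operator gives
  \<open>(n + 1 + \<alpha>) * t ^ n - t ^ (n + 1)\<close>, and the functional annihilates it by the recursion of the moments.
\<close>

lemma Im'_laguerre_subset:
  assumes \<alpha>: "of_rat \<alpha> = of_int a / (of_int b :: complex)" and "b \<noteq> 0" "\<alpha> \<noteq> 0"
  shows "Im' (laguerre_op \<alpha>) \<subseteq> {f. moment_functional (laguerre_moment a b) f = 0}"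
proof
  fix f assume "f \<in> Im' (laguerre_op \<alpha>)"
  then obtain q where fq: "fls_of_poly f = fls_of_poly (pderiv q) +
      (fls_const (of_rat \<alpha>) * fls_X_inv - 1) * fls_of_poly q"
    by (auto simp: Im'_def laguerre_op_def deriv_plus_def fls_deriv_fls_of_poly)
  have "fls_nth (fls_of_poly f) (-1) = of_rat \<alpha> * coeff q 0"
    unfolding fq left_diff_distrib mult.assoc
    by (simp add: fls_nth_fls_of_poly fls_X_inv_times_conv_shift)
  then have "coeff q 0 = 0" using \<open>\<alpha> \<noteq> 0\<close> by (simp add: fls_nth_fls_of_poly)
  then obtain r where q: "q = monom 1 1 * r"
    by (cases q) (auto simp: monom_altdef)
  have "fls_of_poly f = fls_of_poly (pderiv q + smult (of_rat \<alpha>) r - q)"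
  proof -
    have "fls_X_inv * fls_of_poly q = fls_of_poly r"
      unfolding q fls_of_poly_monom1_mult
      by (simp add: mult.assoc[symmetric] fls_X_inv_times_conv_shift fls_X_times_conv_shift)
    then show ?thesis unfolding fq
      by (simp add: fls_of_poly_add fls_of_poly_diff fls_of_poly_smult left_diff_distrib mult.assoc)
  qed
  then have f: "f = pderiv (monom 1 1 * r) + smult (of_rat \<alpha>) r - monom 1 1 * r"
    by (simp only: fls_of_poly_inject q)
  have "moment_functional (laguerre_moment a b)
      (pderiv (monom 1 1 * r) + smult (of_rat \<alpha>) r - monom 1 1 * r) = 0"
  proof (rule additive_vanishing_on_monomials[where f = r])
    fix c :: complex and n
    have "laguerre_moment a b (Suc n) = (of_nat n + 1 + of_rat \<alpha>) * laguerre_moment a b n"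
      using \<open>b \<noteq> 0\<close> unfolding \<alpha> laguerre_moment_def by (simp add: field_simps)
    then show "moment_functional (laguerre_moment a b) (pderiv (monom 1 1 * monom c n) +
        smult (of_rat \<alpha>) (monom c n) - monom 1 1 * monom c n) = 0"
      by (simp add: mult_monom pderiv_monom smult_monom moment_functional_add
          moment_functional_diff moment_functional_monom algebra_simps)
  qed (simp add: distrib_left pderiv_add smult_add_right moment_functional_add moment_functional_diff)
  then show "f \<in> {f. moment_functional (laguerre_moment a b) f = 0}" by (simp add: f)
qed

text \<open>
  For \<open>\<alpha> = 0\<close> the operator is \<open>d/dt - 1\<close>, which is bijective on polynomials.
\<close>

lemma one_mem_Im'_laguerre_0: "1 \<in> Im' (laguerre_op 0)"
proof -
  have "fls_of_poly 1 = laguerre_op 0 (- 1)"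
    by (simp add: laguerre_op_def deriv_plus_def fls_of_poly_def fps_of_poly_uminus)
  then show ?thesis by (auto simp: Im'_def)
qed

lemma strong_image_conjecture_laguerre:
  assumes "\<alpha> > -1"
  shows "strong_image_conjecture (laguerre_op \<alpha>)"
  unfolding strong_image_conjecture_def
proof
  assume "1 \<notin> Im' (laguerre_op \<alpha>)"
  then have "\<alpha> \<noteq> 0" using one_mem_Im'_laguerre_0 by auto
  obtain a b where ab: "quotient_of \<alpha> = (a, b)" by (cases "quotient_of \<alpha>")
  then have b: "b > 0" and eq: "\<alpha> = of_int a / of_int b"
    using quotient_of_denom_pos quotient_of_div by auto
  have "of_int (- b) < (of_int a :: rat)" using assms b by (simp add: eq field_simps)
  then have pos: "0 < a + b" by (simp only: of_int_less_iff)
  have \<alpha>: "of_rat \<alpha> = of_int a / (of_int b :: complex)" by (simp add: eq of_rat_divide)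
  have "f \<notin> power_radical (Im' (laguerre_op \<alpha>))" if "f \<noteq> 0" for f
  proof (rule eventually_prime_nonzero_imp_not_in_radical)
    obtain s where s: "coeff f s \<noteq> 0" "\<forall>i<s. coeff f i = 0"
      using nonzero_poly_order \<open>f \<noteq> 0\<close> by blast
    show "\<forall>\<^sub>F p in sequentially. prime p \<longrightarrow> moment_functional (laguerre_moment a b) (f ^ p) \<noteq> 0"
    proof (rule eventually_moment_prime_power_nonzero[OF s laguerre_moment_def])
      show "1 / of_int b \<noteq> (0::complex)" using b by simp
      show "\<forall>\<^sub>F p in sequentially. prime p \<longrightarrow>
        (\<forall>n\<ge>s * p. int p ^ s dvd progression_prod a b n) \<and>
        \<not> int p ^ Suc s dvd progression_prod a b (s * p) \<and>
        (\<forall>i>s. int p ^ Suc s dvd progression_prod a b (i * p))"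
        using eventually_progression_valuation[OF pos b, of s]
      proof eventually_elim
        case (elim p)
        have "Suc s * p \<le> i * p" if "i > s" for i using that by (intro mult_le_mono1) simp
        then show ?case using elim by blast
      qed
    qed
  qed (use Im'_laguerre_subset[OF \<alpha>] b \<open>\<alpha> \<noteq> 0\<close> in auto)
  then show "power_radical (Im' (laguerre_op \<alpha>)) = {0}"
    using zero_in_radical_Im'_deriv_plus by (auto simp: laguerre_op_def)
qed

section \<open>Hermite polynomials\<close>

definition double_factorial_moment :: "nat \<Rightarrow> int" where
  "double_factorial_moment n = (if even n then progression_prod (-1) 2 (n div 2) else 0)"

text \<open>
  The even moments \<open>1 * 3 * \<dots> * (2 * n - 1) / 2 ^ n\<close> of \<open>exp (- t\<^sup>2)\<close>; the root of \<open>2\<close> writes the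
  denominator as a geometric factor in the exponent \<open>2 * n\<close>.
\<close>

definition hermite_moment :: "nat \<Rightarrow> complex" where
  "hermite_moment n = of_int (double_factorial_moment n) * (1 / complex_of_real (sqrt 2)) ^ n"

text \<open>
  On monomials this is the recursion \<open>2 * L (t ^ (n + 1)) = n * L (t ^ (n - 1))\<close>, an integration by parts;
  for \<open>n = 0\<close> it says that the first moment is zero.
\<close>

lemma Im'_hermite_subset:
  "Im' hermite_op \<subseteq> {f. moment_functional hermite_moment f = 0}"
proof
  fix f assume "f \<in> Im' hermite_op"
  then obtain q where "fls_of_poly f = fls_of_poly (pderiv q) + - 2 * fls_X * fls_of_poly q"
    by (auto simp: Im'_def hermite_op_def deriv_plus_def fls_deriv_fls_of_poly)
  also have "\<dots> = fls_of_poly (pderiv q + smult (- 2) (monom 1 1 * q))"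
    by (simp only: fls_of_poly_add fls_of_poly_smult fls_of_poly_monom1_mult mult.assoc)
      (simp flip: fls_const_numeral)
  finally have f: "f = pderiv q + smult (- 2) (monom 1 1 * q)" by (simp only: fls_of_poly_inject)
  have "moment_functional hermite_moment (pderiv q + smult (- 2) (monom 1 1 * q)) = 0"
  proof (rule additive_vanishing_on_monomials[where f = q])
    fix c :: complex and n
    have "2 * hermite_moment (Suc n) = of_nat n * hermite_moment (n - 1)"
    proof (cases "odd n")
      case True
      then obtain k where n: "n = 2 * k + 1" by (rule oddE)
      have "complex_of_real (sqrt 2) * complex_of_real (sqrt 2) = 2" by (simp flip: of_real_mult)
      then have half: "2 * (1 / complex_of_real (sqrt 2)) ^ Suc (Suc j) =
          (1 / complex_of_real (sqrt 2)) ^ j" for j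
        by (simp add: field_simps)
      have "2 * hermite_moment (Suc n) = of_int (progression_prod (-1) 2 (Suc k)) *
          (2 * (1 / complex_of_real (sqrt 2)) ^ Suc (Suc (2 * k)))"
        by (simp add: n hermite_moment_def double_factorial_moment_def)
      also have "\<dots> = of_int (progression_prod (-1) 2 (Suc k)) * (1 / complex_of_real (sqrt 2)) ^ (2 * k)"
        by (simp only: half)
      also have "\<dots> = of_nat n * hermite_moment (n - 1)"
        by (simp add: n hermite_moment_def double_factorial_moment_def algebra_simps)
      finally show ?thesis .
    next
      case False
      then show ?thesis
        by (cases n) (auto simp: hermite_moment_def double_factorial_moment_def)
    qed
    then show "moment_functional hermite_moment
        (pderiv (monom c n) + smult (- 2) (monom 1 1 * monom c n)) = 0"
      by (simp add: mult_monom pderiv_monom smult_monom moment_functional_add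
          moment_functional_monom algebra_simps)
  qed (simp only: distrib_left pderiv_add smult_add_right moment_functional_add add_ac)
  then show "f \<in> {f. moment_functional hermite_moment f = 0}" by (simp add: f)
qed

lemma square_order:
  fixes f :: "'a::idom poly"
  assumes "coeff f s \<noteq> 0" "\<forall>i<s. coeff f i = 0"
  shows "coeff (f ^ 2) (2 * s) \<noteq> 0" "\<forall>i<2 * s. coeff (f ^ 2) i = 0"
proof -
  have "monom 1 s dvd f" using assms(2) by (simp add: monom_1_dvd_iff')
  then obtain h where h: "f = monom 1 s * h" by (rule dvdE)
  have "f ^ 2 = monom 1 (2 * s) * h ^ 2"
    by (simp add: h power_mult_distrib monom_power mult.commute)
  then show "coeff (f ^ 2) (2 * s) \<noteq> 0"
    using assms(1) by (simp add: h coeff_monom_mult coeff_0_power)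
  show "\<forall>i<2 * s. coeff (f ^ 2) i = 0"
    using coeff_power_below_order[OF assms(2), of _ 2] by (simp add: mult.commute)
qed

text \<open>
  If \<open>f\<close> had odd order \<open>s\<close>, then the moment of \<open>t ^ (s * p)\<close> would be zero for odd \<open>p\<close> and the lowest term
  would be lost. The square of \<open>f\<close> has even order \<open>2 * s\<close>, and the moment of \<open>t ^ (2 * s * p)\<close> has valuation
  \<open>s\<close>. For odd \<open>p\<close>, the exponents \<open>i * p\<close> with \<open>i\<close> odd have zero moments, and
  those with \<open>i = 2 * j > 2 * s\<close> have valuation at least \<open>j \<ge> s + 1\<close>.
\<close>

lemma strong_image_conjecture_hermite: "strong_image_conjecture hermite_op"
  unfolding strong_image_conjecture_def
proof
  have "f \<notin> power_radical (Im' hermite_op)" if "f \<noteq> 0" for f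
  proof -
    obtain s where "coeff f s \<noteq> 0" "\<forall>i<s. coeff f i = 0"
      using nonzero_poly_order \<open>f \<noteq> 0\<close> by blast
    note s = square_order[OF this]
    have "f ^ 2 \<notin> power_radical (Im' hermite_op)"
    proof (rule eventually_prime_nonzero_imp_not_in_radical[OF _ Im'_hermite_subset])
      show "\<forall>\<^sub>F p in sequentially. prime p \<longrightarrow> moment_functional hermite_moment ((f ^ 2) ^ p) \<noteq> 0"
      proof (rule eventually_moment_prime_power_nonzero[OF s hermite_moment_def])
        show "1 / complex_of_real (sqrt 2) \<noteq> 0" by simp
        have "\<forall>\<^sub>F p in sequentially. prime p \<longrightarrow>
           (\<forall>n\<ge>s * p. int p ^ s dvd progression_prod (-1) 2 n) \<and>
           \<not> int p ^ Suc s dvd progression_prod (-1) 2 (s * p) \<and>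
           (\<forall>n\<ge>Suc s * p. int p ^ Suc s dvd progression_prod (-1) 2 n)"
          by (rule eventually_progression_valuation) auto
        then show "\<forall>\<^sub>F p in sequentially. prime p \<longrightarrow>
          (\<forall>n\<ge>2 * s * p. int p ^ s dvd double_factorial_moment n) \<and>
          \<not> int p ^ Suc s dvd double_factorial_moment (2 * s * p) \<and>
          (\<forall>i>2 * s. int p ^ Suc s dvd double_factorial_moment (i * p))"
          using eventually_gt_at_top[of 2]
        proof eventually_elim
          case (elim p)
          show ?case
          proof
            assume "prime p"
            then have "odd p" using elim(2) prime_odd_nat by blast
            have low: "int p ^ s dvd double_factorial_moment n" if "n \<ge> 2 * s * p" for n
            proof -
              have "s * p \<le> n div 2" using that by simp
              then show ?thesis
                using elim(1) \<open>prime p\<close> by (simp add: double_factorial_moment_def)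
            qed
            have high: "int p ^ Suc s dvd double_factorial_moment (i * p)" if "i > 2 * s" for i
            proof (cases "even i")
              case True
              then obtain j where j: "i = 2 * j" by (rule evenE)
              then have "Suc s * p \<le> j * p" using that by (intro mult_le_mono1) simp
              then show ?thesis
                using elim(1) \<open>prime p\<close> by (simp add: double_factorial_moment_def j mult.assoc)
            qed (use \<open>odd p\<close> in \<open>simp add: double_factorial_moment_def\<close>)
            show "(\<forall>n\<ge>2 * s * p. int p ^ s dvd double_factorial_moment n) \<and>
              \<not> int p ^ Suc s dvd double_factorial_moment (2 * s * p) \<and>
              (\<forall>i>2 * s. int p ^ Suc s dvd double_factorial_moment (i * p))"
              using low high elim(1) \<open>prime p\<close> by (simp add: double_factorial_moment_def mult.assoc)
          qed
        qed
      qed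
    qed
    then show ?thesis using power_in_power_radical[of f _ 2] by auto
  qed
  then show "power_radical (Im' hermite_op) = {0}"
    using zero_in_radical_Im'_deriv_plus by (auto simp: hermite_op_def)
qed

theorem corollary6p3:
  shows "strong_image_conjecture hermite_op \<and>
    (\<forall>\<alpha>::rat. \<alpha> > -1 \<longrightarrow> strong_image_conjecture (laguerre_op \<alpha>))"
  using strong_image_conjecture_hermite strong_image_conjecture_laguerre by blast

end
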